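(* Let $h(x)=\mathbb E_\xi[\mathbf H(x,\xi)]$ for $x\in X$, and let $$\tilde h_\mu(x)=\mathbb E_{v,\xi}[\mathbf H(x+\mu v,\xi)],$$ where the auxiliary random vector $v\sim\mathcal N(0,I_d)$. Assume that $\mathbf H(\cdot,\xi)$ is $L_0$-Lipschitz for a.e. $\xi\in\Xi$. Then: (i) $\tilde h_\mu$ is a smoothing function of $h$ with parameters $(\kappa,K,\mathcal L_h)=(L_0\sqrt d,\,0,\,L_0)$. (ii) The unbiasedness and bounded-variance condition holds for the stochastic gradient $\nabla\tilde{\mathbf\Psi}_\mu(x,\zeta)$ with $\zeta=(\xi^T,v^T)^T$ and $\sigma^2=L_0^2$.
   Context: **Setting.** $X\subseteq\mathbb R^d$ is closed and convex; $\xi$ is a random vector with support $\Xi$, independent of $v$; $\mathbf H(\cdot,\xi)$ are closed proper convex functions (defined on $\mathbb R^d$, where the Lipschitz condition is understood); $h$ is finite-valued and continuous on $X$; $f:X\to\mathbb R$ is convex with Lipschitz gradient. $\|\cdot\|$ is the Euclidean norm. $\bar\mu>0$ is arbitrary. **Smoothing function.** For convex $c:X\to\mathbb R$, a function $\tilde c:X\times(0,\bar\mu]\to\mathbb R$ (write $\tilde c_\mu=\tilde c(\cdot,\mu)$) is a smoothing function of $c$ with parameters $(\kappa,K,\mathcal L_c)$ if for every $\mu\in(0,\bar\mu]$, $\tilde c_\mu$ is continuously differentiable on $X$ and: (a) $\lim_{z\to x,\mu\downarrow0}\tilde c(z,\mu)=c(x)$ for all $x\in X$; (b) $\tilde c_\mu$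 is convex on $X$; (c) $|\tilde c(x,\mu_2)-\tilde c(x,\mu_1)|\le\kappa|\mu_1-\mu_2|$ for all $x\in X$, $\mu_1,\mu_2\in(0,\bar\mu]$, with constant $\kappa>0$; (d) $\nabla\tilde c_\mu$ is Lipschitz on $X$ with constant $K+\mathcal L_c/\mu$, where $K$ and $\mathcal L_c>0$ do not depend on $\mu$. **Stochastic gradient.** $\tilde\psi_\mu=f+\tilde h_\mu$, and $\nabla\tilde{\mathbf\Psi}_\mu(x,\zeta)=\nabla f(x)+g$ with $g\in\partial\mathbf H(x+\mu v,\xi)$ a (measurably selected) subgradient of the convex function $\mathbf H(\cdot,\xi)$ at $x+\mu v$. **Unbiasedness and bounded-variance condition** (with constant $\sigma^2$ independent of $\mu$): for every $x\in X$ and $\mu\in(0,\bar\mu]$, $\mathbb E_\zeta[\nabla\tilde{\mathbf\Psi}_\mu(x,\zeta)]=\nabla\tilde\psi_\mu(x)$ and $\mathbb E_\zeta[\|\nabla\tilde{\mathbf\Psi}_\mu(x,\zeta)-\nabla\tilde\psi_\mu(x)\|^2]\le\sigma^2$. *)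

theory Defs
  imports "HOL-Probability.Probability"
begin

text \<open>Extended-real-valued convex functions.  The library's \<^verbatim>\<open>epigraph\<close> is for
  real-valued functions only.\<close>

definition ereal_epigraph :: "('a \<Rightarrow> ereal) \<Rightarrow> ('a \<times> real) set" where
  "ereal_epigraph F = {(x, t). F x \<le> ereal t}"

definition closed_proper_convex :: "('a::euclidean_space \<Rightarrow> ereal) \<Rightarrow> bool" where
  "closed_proper_convex F \<longleftrightarrow>
     convex (ereal_epigraph F) \<and> closed (ereal_epigraph F) \<and>
     (\<forall>x. F x \<noteq> -\<infinity>) \<and> (\<exists>x. F x \<noteq> \<infinity>)"

definition subdifferential :: "('a::euclidean_space \<Rightarrow> ereal) \<Rightarrow> 'a \<Rightarrow> 'a set" where
  "subdifferential F x = {g. \<forall>y. F x + ereal (g \<bullet> (y - x)) \<le> F y}"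

definition ereal_lipschitz :: "real \<Rightarrow> ('a::euclidean_space \<Rightarrow> ereal) \<Rightarrow> bool" where
  "ereal_lipschitz L F \<longleftrightarrow>
     (\<forall>x. \<bar>F x\<bar> \<noteq> \<infinity>) \<and> L-lipschitz_on UNIV (\<lambda>x. real_of_ereal (F x))"

text \<open>\<^verbatim>\<open>grad\<close> is the gradient in the ambient space, meaningful only where \<^verbatim>\<open>F\<close> is
  differentiable there.  For a function that matters only on a set \<^verbatim>\<open>X\<close>, a gradient is a
  field representing the derivative relative to \<^verbatim>\<open>X\<close>; for convex \<^verbatim>\<open>X\<close> it is unique if
  \<^verbatim>\<open>X\<close> has interior points, but not otherwise, so the field is carried explicitly.\<close>

definition grad :: "('a::euclidean_space \<Rightarrow> real) \<Rightarrow> 'a \<Rightarrow> 'a" where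
  "grad F x = (THE D. GDERIV F x :> D)"

definition has_gradient_on ::
    "('a::euclidean_space \<Rightarrow> real) \<Rightarrow> ('a \<Rightarrow> 'a) \<Rightarrow> 'a set \<Rightarrow> bool" where
  "has_gradient_on F D X \<longleftrightarrow> (\<forall>x\<in>X. (F has_derivative (\<lambda>h. h \<bullet> D x)) (at x within X))"

text \<open>The second argument of \<^verbatim>\<open>ct\<close> is the smoothing parameter, and \<^verbatim>\<open>Dct x \<mu>\<close> is the
  gradient of \<^verbatim>\<open>ct\<close> in its first argument.  As no point \<^verbatim>\<open>(x, 0)\<close> belongs to
  \<^verbatim>\<open>X \<times> {0<..\<mu>b}\<close>, the limit includes \<^verbatim>\<open>z = x\<close>.\<close>

definition smoothing_function ::
    "'a::euclidean_space set \<Rightarrow> real \<Rightarrow> ('a \<Rightarrow> real) \<Rightarrow> ('a \<Rightarrow> real \<Rightarrow> real) \<Rightarrow>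
     ('a \<Rightarrow> real \<Rightarrow> 'a) \<Rightarrow> real \<Rightarrow> real \<Rightarrow> real \<Rightarrow> bool" where
  "smoothing_function X \<mu>b c ct Dct \<kappa> K L \<longleftrightarrow>
     convex_on X c \<and> 0 < \<kappa> \<and> 0 < L \<and>
     (\<forall>\<mu>\<in>{0<..\<mu>b}. has_gradient_on (\<lambda>x. ct x \<mu>) (\<lambda>x. Dct x \<mu>) X \<and>
                   continuous_on X (\<lambda>x. Dct x \<mu>)) \<and>
     (\<forall>x\<in>X. ((\<lambda>(z, \<mu>). ct z \<mu>) \<longlongrightarrow> c x) (at (x, 0) within X \<times> {0<..\<mu>b})) \<and>
     (\<forall>\<mu>\<in>{0<..\<mu>b}. convex_on X (\<lambda>x. ct x \<mu>)) \<and>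
     (\<forall>x\<in>X. \<forall>\<mu>1\<in>{0<..\<mu>b}. \<forall>\<mu>2\<in>{0<..\<mu>b}. \<bar>ct x \<mu>2 - ct x \<mu>1\<bar> \<le> \<kappa> * \<bar>\<mu>1 - \<mu>2\<bar>) \<and>
     (\<forall>\<mu>\<in>{0<..\<mu>b}. (K + L / \<mu>)-lipschitz_on X (\<lambda>x. Dct x \<mu>))"

definition unbiased_bounded_variance ::
    "'w measure \<Rightarrow> ('w \<Rightarrow> 'z) \<Rightarrow> 'a::euclidean_space set \<Rightarrow> real \<Rightarrow>
     ('a \<Rightarrow> real \<Rightarrow> 'a) \<Rightarrow> ('a \<Rightarrow> real \<Rightarrow> 'z \<Rightarrow> 'a) \<Rightarrow> real \<Rightarrow> bool" where
  "unbiased_bounded_variance M \<zeta> X \<mu>b D\<psi> D\<Psi> \<sigma>2 \<longleftrightarrow>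
     (\<forall>x\<in>X. \<forall>\<mu>\<in>{0<..\<mu>b}.
        integrable M (\<lambda>\<omega>. D\<Psi> x \<mu> (\<zeta> \<omega>)) \<and>
        (LINT \<omega>|M. D\<Psi> x \<mu> (\<zeta> \<omega>)) = D\<psi> x \<mu> \<and>
        integrable M (\<lambda>\<omega>. (norm (D\<Psi> x \<mu> (\<zeta> \<omega>) - D\<psi> x \<mu>))\<^sup>2) \<and>
        (LINT \<omega>|M. (norm (D\<Psi> x \<mu> (\<zeta> \<omega>) - D\<psi> x \<mu>))\<^sup>2) \<le> \<sigma>2)"

text \<open>The smallest closed set carrying the law of \<^verbatim>\<open>Y\<close>.\<close>

definition rv_support :: "'w measure \<Rightarrow> ('w \<Rightarrow> 'b::euclidean_space) \<Rightarrow> 'b set" where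
  "rv_support M Y =
     {s. \<forall>U. open U \<and> s \<in> U \<longrightarrow> 0 < measure M {\<omega> \<in> space M. Y \<omega> \<in> U}}"

text \<open>Lebesgue density of the centred Gaussian law with identity covariance.\<close>

definition std_gaussian_density :: "'a::euclidean_space \<Rightarrow> real" where
  "std_gaussian_density x = (\<Prod>b\<in>Basis. std_normal_density (x \<bullet> b))"

end

theory Submission
  imports Defs
begin

text \<open>The randomness in \<open>\<xi>\<close> can be averaged out first.  The function
  \<open>G(y) = E[H(y, \<xi>)]\<close> is convex and \<open>L0\<close>-Lipschitz on the whole space and equals \<open>h\<close> on \<open>X\<close>;
  since \<open>\<xi>\<close> and \<open>v\<close> are independent, Fubini's theorem
  (\<open>expectation_indep_iterated\<close>) gives \<open>h\<^sub>s(x, \<mu>) = E[G(x + \<mu> u)]\<close> with \<open>u\<close> standard Gaussian.  So the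
  first part concerns the Gaussian smoothing of one deterministic function.

  Convexity is inherited by averaging.  Differentiability comes from the kernel: shifting
  \<open>u\<close> by \<open>a\<close> is the same as weighting with \<open>exp (u \<bullet> a - \<parallel>a\<parallel>\<^sup>2 / 2)\<close>
  (\<open>integral_std_gaussian_translate\<close>), and the first-order expansion of this weight shows that
  the gradient is \<open>E[G(x + \<mu> u) u] / \<mu>\<close> (\<open>GDERIV_gaussian_smoothing\<close>).  The constants come from
  two moment bounds.  Paired with a direction \<open>w\<close>, the difference of the gradients at \<open>x\<close> and
  \<open>y\<close> is at most \<open>L0 \<parallel>x - y\<parallel> E\<bar>u \<bullet> w\<bar> / \<mu>\<close>, and \<open>E\<bar>u \<bullet> w\<bar> \<le> \<parallel>w\<parallel>\<close> yields \<open>L0 / \<mu>\<close>; changing the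
  smoothing parameter moves the argument of \<open>G\<close> by \<open>\<bar>\<mu>1 - \<mu>2\<bar> \<parallel>u\<parallel>\<close>, and \<open>E\<parallel>u\<parallel> \<le> \<surd>d\<close> yields
  \<open>L0 \<surd>d\<close>.

  For the second part, the mean of the random subgradients is a subgradient of
  \<open>h\<^sub>s(\<cdot>, \<mu>)\<close> at \<open>x\<close>, and a function with a gradient at \<open>x\<close> has no other subgradient there
  (\<open>GDERIV_subgradient_unique\<close>); hence unbiasedness.  Subgradients of an \<open>L0\<close>-Lipschitz function
  have norm at most \<open>L0\<close> (\<open>subgradient_norm_le\<close>), so their second moment, and a fortiori their
  variance, is at most \<open>L0\<^sup>2\<close>.\<close>

section \<open>The standard Gaussian law\<close>

definition std_gaussian :: "'a::euclidean_space measure" where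
  "std_gaussian = density lborel (\<lambda>x. ennreal (std_gaussian_density x))"

lemma std_gaussian_density_nonneg: "0 \<le> std_gaussian_density x"
  unfolding std_gaussian_density_def by (intro prod_nonneg) simp

lemma std_gaussian_density_measurable [measurable]:
  "std_gaussian_density \<in> borel_measurable borel"
  unfolding std_gaussian_density_def[abs_def] by measurable

lemma sets_std_gaussian [measurable_cong, simp]: "sets std_gaussian = sets borel"
  by (simp add: std_gaussian_def)

lemma space_std_gaussian [simp]: "space std_gaussian = UNIV"
  by (simp add: std_gaussian_def)

lemma prob_space_std_gaussian: "prob_space (std_gaussian :: 'a::euclidean_space measure)"
proof
  have "emeasure (std_gaussian :: 'a measure) (space std_gaussian)
      = (\<integral>\<^sup>+x. ennreal (\<Prod>b\<in>(Basis::'a set). std_normal_density (x \<bullet> b)) \<partial>lborel)"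
    unfolding std_gaussian_def
    by (subst emeasure_density) (auto simp: std_gaussian_density_def)
  also have "\<dots> = (\<integral>\<^sup>+x. (\<Prod>b\<in>(Basis::'a set). ennreal (std_normal_density (x \<bullet> b))) \<partial>lborel)"
    by (simp add: prod_ennreal)
  also have "\<dots> = (\<Prod>b\<in>(Basis::'a set). \<integral>\<^sup>+x. ennreal (std_normal_density x) \<partial>lborel)"
    by (rule nn_integral_lborel_prod) auto
  also have "(\<integral>\<^sup>+x. ennreal (std_normal_density x) \<partial>lborel) = 1"
    by (subst nn_integral_eq_integral) auto
  finally show "emeasure (std_gaussian :: 'a measure) (space std_gaussian) = 1" by simp
qed

interpretation std_gaussian: prob_space "std_gaussian :: 'a::euclidean_space measure"
  by (rule prob_space_std_gaussian)

text \<open>Completing the square: translating the density by \<open>a\<close> multiplies it by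
  \<open>exp (u \<bullet> a - \<parallel>a\<parallel>\<^sup>2 / 2)\<close>, a weight that is smooth in \<open>a\<close>.\<close>

lemma std_gaussian_density_translate:
  fixes u a :: "'a::euclidean_space"
  shows "std_gaussian_density (u - a) = std_gaussian_density u * exp (u \<bullet> a - (norm a)\<^sup>2 / 2)"
proof -
  have 1: "std_normal_density (s - t) = std_normal_density s * exp (s * t - t * t / 2)" for s t
  proof -
    have e: "- (s - t)\<^sup>2 / 2 = - s\<^sup>2 / 2 + (s * t - t * t / 2)"
      by (simp add: power2_eq_square field_simps)
    show ?thesis
      unfolding std_normal_density_def e exp_add by simp
  qed
  have e: "u \<bullet> a - (norm a)\<^sup>2 / 2
      = (\<Sum>b\<in>Basis. (u \<bullet> b) * (a \<bullet> b) - (a \<bullet> b) * (a \<bullet> b) / 2)"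
    unfolding power2_norm_eq_inner euclidean_inner[of u a] euclidean_inner[of a a]
    by (simp add: sum_subtractf sum_divide_distrib)
  show ?thesis
    unfolding std_gaussian_density_def e exp_sum[OF finite_Basis] inner_diff_left 1
    by (simp add: prod.distrib)
qed

text \<open>The Cameron--Martin formula for constant shifts.  It moves a translation from an arbitrary
  integrand \<open>k\<close> onto an exponential weight, which is what makes integrals of nonsmooth
  functions differentiable in the shift.  It holds because \<open>lborel\<close> is translation
  invariant.\<close>

lemma
  fixes a :: "'a::euclidean_space" and k :: "'a \<Rightarrow> 'b::{banach, second_countable_topology}"
  assumes [measurable]: "k \<in> borel_measurable borel"
  shows integrable_std_gaussian_translate:
      "integrable std_gaussian (\<lambda>u. k (u + a))
        \<longleftrightarrow> integrable std_gaussian (\<lambda>u. exp (u \<bullet> a - (norm a)\<^sup>2 / 2) *\<^sub>R k u)" (is ?I)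
    and integral_std_gaussian_translate:
      "(LINT u|std_gaussian. k (u + a))
        = (LINT u|std_gaussian. exp (u \<bullet> a - (norm a)\<^sup>2 / 2) *\<^sub>R k u)" (is ?E)
proof -
  let ?p = "std_gaussian_density :: 'a \<Rightarrow> real"
  let ?q = "\<lambda>u. ?p (u - a) *\<^sub>R k u"
  have D: "lborel = distr lborel borel ((+) a)" by (simp add: lborel_distr_plus)
  have w: "?q u = ?p u *\<^sub>R (exp (u \<bullet> a - (norm a)\<^sup>2 / 2) *\<^sub>R k u)" for u
    by (simp add: std_gaussian_density_translate)
  have q: "?q = (\<lambda>u. ?p u *\<^sub>R (exp (u \<bullet> a - (norm a)\<^sup>2 / 2) *\<^sub>R k u))"
    using w by blast
  have "integrable lborel ?q \<longleftrightarrow> integrable lborel (\<lambda>u. ?p u *\<^sub>R k (u + a))"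
    by (subst D) (simp add: integrable_distr_eq add.commute)
  then show ?I
    unfolding q
    by (simp add: std_gaussian_def integrable_density std_gaussian_density_nonneg)
  have "integral\<^sup>L lborel ?q = integral\<^sup>L lborel (\<lambda>u. ?p u *\<^sub>R k (u + a))"
    by (subst D) (simp add: integral_distr add.commute)
  then show ?E
    unfolding q
    by (simp add: std_gaussian_def integral_density std_gaussian_density_nonneg)
qed

text \<open>The moment generating function is the Cameron--Martin formula for the constant \<open>1\<close>.  All
  moment bounds below are read off from it.\<close>

lemma
  fixes a :: "'a::euclidean_space"
  shows integrable_std_gaussian_exp_inner: "integrable std_gaussian (\<lambda>u. exp (u \<bullet> a))" (is ?I)
    and integral_std_gaussian_exp_inner:
      "(LINT u|std_gaussian. exp (u \<bullet> a)) = exp ((norm a)\<^sup>2 / 2)" (is ?E)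
proof -
  let ?c = "exp ((norm a)\<^sup>2 / 2)"
  let ?w = "\<lambda>u. exp (u \<bullet> a - (norm a)\<^sup>2 / 2)"
  have eq: "(\<lambda>u. exp (u \<bullet> a)) = (\<lambda>u. ?c * ?w u)"
    by (simp add: exp_add[symmetric])
  have i: "integrable std_gaussian ?w"
    using integrable_std_gaussian_translate[of "\<lambda>_. 1::real" a] by simp
  then show ?I unfolding eq by simp
  have "(LINT u|std_gaussian. ?w u) = 1"
    using integral_std_gaussian_translate[of "\<lambda>_. 1::real" a]
      std_gaussian.prob_space[where 'a = 'a]
    by simp
  then show ?E unfolding eq using i by simp
qed

text \<open>The norm is at most the dimension times the largest coordinate, so \<open>exp (c * norm u)\<close> is
  dominated by finitely many exponentials of linear forms.\<close>

lemma integrable_std_gaussian_exp_norm: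
  assumes "0 \<le> c"
  shows "integrable std_gaussian (\<lambda>u::'a::euclidean_space. exp (c * norm u))"
proof (rule Bochner_Integration.integrable_bound)
  let ?k = "c * real DIM('a)"
  let ?S = "\<lambda>u::'a. \<Sum>b\<in>Basis. exp (u \<bullet> (?k *\<^sub>R b)) + exp (u \<bullet> (- ?k *\<^sub>R b))"
  show "integrable std_gaussian ?S"
    by (intro Bochner_Integration.integrable_sum Bochner_Integration.integrable_add
        integrable_std_gaussian_exp_inner)
  show "(\<lambda>u::'a. exp (c * norm u)) \<in> borel_measurable std_gaussian" by measurable
  have "exp (c * norm u) \<le> ?S u" for u :: 'a
  proof -
    let ?m = "Max ((\<lambda>b. \<bar>u \<bullet> b\<bar>) ` Basis)"
    have "?m \<in> (\<lambda>b. \<bar>u \<bullet> b\<bar>) ` Basis" by (intro Max_in) auto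
    then obtain b where b: "b \<in> Basis" "?m = \<bar>u \<bullet> b\<bar>" by blast
    have "norm u \<le> (\<Sum>b\<in>Basis. \<bar>u \<bullet> b\<bar>)" by (rule norm_le_l1)
    also have "\<dots> \<le> real DIM('a) * ?m"
      by (rule sum_bounded_above) auto
    finally have "c * norm u \<le> ?k * \<bar>u \<bullet> b\<bar>"
      using mult_left_mono[OF _ assms] b by (simp add: mult.assoc)
    then have "exp (c * norm u) \<le> exp (?k * \<bar>u \<bullet> b\<bar>)" by simp
    also have "\<dots> \<le> exp (u \<bullet> (?k *\<^sub>R b)) + exp (u \<bullet> (- ?k *\<^sub>R b))"
      by (cases "0 \<le> u \<bullet> b") auto
    also have "\<dots> \<le> ?S u"
      by (rule member_le_sum) (use b in auto)
    finally show ?thesis .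
  qed
  moreover have "0 \<le> ?S u" for u by (intro sum_nonneg) simp
  ultimately show "AE u in std_gaussian. norm (exp (c * norm u)) \<le> norm (?S u)" by simp
qed

text \<open>The even Taylor terms add up and the odd ones cancel; the cubic lower bound for \<open>exp\<close> holds
  on the whole line because the next Taylor term has even degree.\<close>

lemma quadratic_le_exp_sum: "2 + x\<^sup>2 \<le> exp x + exp (- x)" for x :: real
proof -
  have cubic: "1 + t + t\<^sup>2 / 2 + t ^ 3 / 6 \<le> exp t" for t :: real
  proof -
    obtain s where "exp t = (\<Sum>m<4. t ^ m / fact m) + (exp s / fact 4) * t ^ 4"
      using Maclaurin_exp_le[of t 4] by auto
    moreover have "0 \<le> (exp s / fact 4) * t ^ 4" by simp
    moreover have "(\<Sum>m<4. t ^ m / fact m) = 1 + t + t\<^sup>2 / 2 + t ^ 3 / 6"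
      by (simp add: eval_nat_numeral)
    ultimately show ?thesis by linarith
  qed
  show ?thesis using cubic[of x] cubic[of "- x"] by simp
qed

lemma integrable_std_gaussian_norm_power:
  "integrable std_gaussian (\<lambda>u::'a::euclidean_space. norm u ^ n)"
proof (rule Bochner_Integration.integrable_bound)
  show "integrable std_gaussian (\<lambda>u::'a. exp (real n * norm u))"
    by (rule integrable_std_gaussian_exp_norm) simp
  have "norm u ^ n \<le> exp (real n * norm u)" for u :: 'a
  proof -
    have "norm u \<le> exp (norm u)"
      using exp_ge_add_one_self[of "norm u"] by linarith
    then have "norm u ^ n \<le> exp (norm u) ^ n" by (rule power_mono) simp
    then show ?thesis by (simp add: exp_of_nat_mult)
  qed
  then show "AE u in std_gaussian. norm (norm (u::'a) ^ n) \<le> norm (exp (real n * norm u))" by simp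
qed measurable

lemma integrable_std_gaussian_inner_square:
  "integrable std_gaussian (\<lambda>u::'a::euclidean_space. (u \<bullet> w)\<^sup>2)"
proof (rule Bochner_Integration.integrable_bound)
  show "integrable std_gaussian (\<lambda>u::'a. (norm w)\<^sup>2 * norm u ^ 2)"
    by (intro integrable_mult_right integrable_std_gaussian_norm_power)
  have "(u \<bullet> w)\<^sup>2 \<le> (norm w)\<^sup>2 * norm u ^ 2" for u :: 'a
    using power_mono[OF Cauchy_Schwarz_ineq2[of u w] abs_ge_zero, of 2]
    by (simp add: power_mult_distrib mult.commute)
  then show "AE u in std_gaussian. norm ((u \<bullet> w)\<^sup>2) \<le> norm ((norm w)\<^sup>2 * norm (u::'a) ^ 2)" by simp
qed measurable

text \<open>For \<open>e > 0\<close>, integrating \<open>2 + e s\<^sup>2 \<le> exp (sqrt e * s) + exp (- sqrt e * s)\<close> at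
  \<open>s = u \<bullet> w\<close> bounds the second moment by the difference quotient
  \<open>2 (exp (e \<parallel>w\<parallel>\<^sup>2 / 2) - 1) / e\<close>, which tends to \<open>\<parallel>w\<parallel>\<^sup>2\<close> as \<open>e\<close> decreases to \<open>0\<close>.\<close>

lemma std_gaussian_inner_square_le:
  fixes w :: "'a::euclidean_space"
  shows "(LINT u|std_gaussian. (u \<bullet> w)\<^sup>2) \<le> (norm w)\<^sup>2"
proof -
  let ?I = "LINT u|std_gaussian. (u \<bullet> w)\<^sup>2"
  let ?r = "(norm w)\<^sup>2 / 2"
  let ?q = "\<lambda>e. 2 * ((exp (e * ?r) - 1) / e)"
  have le: "?I \<le> ?q e" if "0 < e" for e :: real
  proof -
    have i: "integrable std_gaussian (\<lambda>u. 2 + e * (u \<bullet> w)\<^sup>2)"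
      using integrable_std_gaussian_inner_square[of w] by simp
    have "2 + e * ?I = (LINT u|std_gaussian. 2 + e * (u \<bullet> w)\<^sup>2)"
      using integrable_std_gaussian_inner_square[of w] std_gaussian.prob_space[where 'a='a] by simp
    also have "\<dots> \<le> (LINT u|std_gaussian. exp (u \<bullet> (sqrt e *\<^sub>R w)) + exp (u \<bullet> (- sqrt e *\<^sub>R w)))"
    proof (rule integral_mono[OF i])
      show "integrable std_gaussian
          (\<lambda>u. exp (u \<bullet> (sqrt e *\<^sub>R w)) + exp (u \<bullet> (- sqrt e *\<^sub>R w)))"
        by (intro Bochner_Integration.integrable_add integrable_std_gaussian_exp_inner)
      show "2 + e * (u \<bullet> w)\<^sup>2 \<le> exp (u \<bullet> (sqrt e *\<^sub>R w)) + exp (u \<bullet> (- sqrt e *\<^sub>R w))" for u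
        using quadratic_le_exp_sum[of "sqrt e * (u \<bullet> w)"] that by (simp add: power_mult_distrib)
    qed
    also have "\<dots> = 2 * exp (e * ?r)"
      using that
      by (subst Bochner_Integration.integral_add)
         (simp_all only: integrable_std_gaussian_exp_inner integral_std_gaussian_exp_inner,
          simp add: power_mult_distrib)
    finally show ?thesis using that by (simp add: field_simps)
  qed
  have "((\<lambda>e. exp (e * ?r)) has_field_derivative ?r) (at 0)"
    by (auto intro!: derivative_eq_intros)
  then have "((\<lambda>e. (exp (e * ?r) - 1) / e) \<longlongrightarrow> ?r) (at 0)"
    by (simp add: has_field_derivative_iff)
  then have "(?q \<longlongrightarrow> 2 * ?r) (at_right 0)"
    by (intro tendsto_mult_left) (rule filterlim_mono[OF _ order_refl], auto simp: at_within_le_at)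
  moreover have "\<forall>\<^sub>F e in at_right 0. ?I \<le> ?q e"
    using le by (auto simp: eventually_at_filter)
  ultimately have "?I \<le> 2 * ?r"
    by (rule tendsto_lowerbound) simp
  then show ?thesis by simp
qed

text \<open>This is nonnegativity of the variance of \<open>\<bar>Y\<bar>\<close>.\<close>

lemma (in prob_space) expectation_abs_le_of_square:
  fixes Y :: "'a \<Rightarrow> real"
  assumes Y: "Y \<in> borel_measurable M"
    and i: "integrable M (\<lambda>x. (Y x)\<^sup>2)" and le: "expectation (\<lambda>x. (Y x)\<^sup>2) \<le> c\<^sup>2" and "0 \<le> c"
  shows "expectation (\<lambda>x. \<bar>Y x\<bar>) \<le> c"
proof -
  have iY: "integrable M (\<lambda>x. \<bar>Y x\<bar>)"
    using square_integrable_imp_integrable[OF Y i] by simp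
  have "0 \<le> variance (\<lambda>x. \<bar>Y x\<bar>)" by (rule variance_positive)
  also have "variance (\<lambda>x. \<bar>Y x\<bar>) = expectation (\<lambda>x. (Y x)\<^sup>2) - (expectation (\<lambda>x. \<bar>Y x\<bar>))\<^sup>2"
    using variance_eq[OF iY] i by simp
  finally have "(expectation (\<lambda>x. \<bar>Y x\<bar>))\<^sup>2 \<le> c\<^sup>2" using le by simp
  then show ?thesis using \<open>0 \<le> c\<close> by (rule power2_le_imp_le)
qed

text \<open>This bound is free of the dimension; it is responsible for the smoothness constant
  \<open>L / \<mu>\<close> of the smoothed function.\<close>

lemma std_gaussian_abs_inner_le:
  "(LINT u|std_gaussian. \<bar>u \<bullet> w\<bar>) \<le> norm (w::'a::euclidean_space)"
  by (rule std_gaussian.expectation_abs_le_of_square)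
     (auto simp: integrable_std_gaussian_inner_square std_gaussian_inner_square_le)

text \<open>Summing the second moments over the coordinates gives \<open>\<surd>d\<close>, the factor that
  enters the Lipschitz constant of the smoothed function in the smoothing parameter.\<close>

lemma std_gaussian_norm_le:
  "(LINT u|std_gaussian. norm (u::'a::euclidean_space)) \<le> sqrt (real DIM('a))"
proof -
  have "(LINT u|std_gaussian. (norm (u::'a))\<^sup>2) = (\<Sum>b\<in>Basis. LINT u|std_gaussian. (u \<bullet> (b::'a))\<^sup>2)"
    unfolding power2_norm_eq_inner euclidean_inner[of u u for u :: 'a] power2_eq_square[symmetric]
    by (simp add: integrable_std_gaussian_inner_square)
  also have "\<dots> \<le> (\<Sum>b\<in>(Basis::'a set). (norm b)\<^sup>2)"
    by (intro sum_mono std_gaussian_inner_square_le)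
  finally have "(LINT u|std_gaussian. (norm (u::'a))\<^sup>2) \<le> (sqrt (real DIM('a)))\<^sup>2" by simp
  then have "(LINT u|std_gaussian. \<bar>norm (u::'a)\<bar>) \<le> sqrt (real DIM('a))"
    by (intro std_gaussian.expectation_abs_le_of_square)
       (auto simp: integrable_std_gaussian_norm_power)
  then show ?thesis by simp
qed

section \<open>Gaussian smoothing of a Lipschitz function\<close>

definition gaussian_smoothing :: "('a::euclidean_space \<Rightarrow> real) \<Rightarrow> 'a \<Rightarrow> real \<Rightarrow> real" where
  "gaussian_smoothing G x \<mu> = (LINT u|std_gaussian. G (x + \<mu> *\<^sub>R u))"

text \<open>Formally the result of differentiating the Gaussian kernel instead of \<open>G\<close>: the standard
  Gaussian density has gradient \<open>- u\<close> times itself.\<close>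

definition gaussian_smoothing_gradient :: "('a::euclidean_space \<Rightarrow> real) \<Rightarrow> 'a \<Rightarrow> real \<Rightarrow> 'a" where
  "gaussian_smoothing_gradient G x \<mu> = (LINT u|std_gaussian. G (x + \<mu> *\<^sub>R u) *\<^sub>R u) /\<^sub>R \<mu>"

text \<open>The Cameron--Martin weight \<open>exp (t - a\<^sup>2 / 2)\<close>, with \<open>t = u \<bullet> a\<close> and \<open>b\<close> the norm of \<open>u\<close>, is
  \<open>1 + t\<close> up to an error quadratic in \<open>a\<close>.  The growth in \<open>b\<close> is only exponential, hence
  integrable against the Gaussian law.\<close>

lemma exp_linear_remainder:
  fixes t q a b :: real
  assumes t: "\<bar>t\<bar> \<le> a * b" and q: "q = a\<^sup>2 / 2" and a: "0 \<le> a" "a \<le> 1" and b: "0 \<le> b"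
  shows "\<bar>exp (t - q) - 1 - t\<bar> \<le> 2 * a\<^sup>2 * exp (3 * (1 + b))"
proof -
  define r where "r = t - q"
  have "a * a \<le> a * 1" using a by (intro mult_left_mono) auto
  then have "\<bar>r\<bar> \<le> a * b + a"
    using t a zero_le_square[of a] unfolding r_def q power2_eq_square by linarith
  then have r: "\<bar>r\<bar> \<le> a * (1 + b)" by (simp add: algebra_simps)
  also have "\<dots> \<le> 1 * (1 + b)" using a b by (intro mult_right_mono) auto
  finally have r1: "\<bar>r\<bar> \<le> 1 + b" by simp
  obtain s where s: "\<bar>s\<bar> \<le> \<bar>r\<bar>" "exp r = (\<Sum>m<2. r ^ m / fact m) + (exp s / fact 2) * r ^ 2"
    using Maclaurin_exp_le[of r 2] by blast
  have e2: "exp r - 1 - r = exp s / 2 * r\<^sup>2" using s(2) by (simp add: eval_nat_numeral)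
  have "r\<^sup>2 \<le> (a * (1 + b))\<^sup>2" using r by (rule abs_le_square_iff[THEN iffD1, OF order_trans]) simp
  also have "\<dots> = a\<^sup>2 * (1 + b)\<^sup>2" by (rule power_mult_distrib)
  also have "\<dots> \<le> a\<^sup>2 * (exp (1 + b))\<^sup>2"
    using exp_ge_add_one_self[of "1 + b"] b by (intro mult_left_mono power_mono) auto
  finally have r2: "r\<^sup>2 \<le> a\<^sup>2 * (exp (1 + b))\<^sup>2" .
  have "exp s \<le> exp (1 + b)" using s(1) r1 by simp
  then have "exp s * r\<^sup>2 \<le> exp (1 + b) * (a\<^sup>2 * (exp (1 + b))\<^sup>2)"
    using r2 by (intro mult_mono) auto
  also have "\<dots> = a\<^sup>2 * exp (3 * (1 + b))"
    by (simp add: exp_of_nat_mult[of 3, symmetric, simplified] power2_eq_square power3_eq_cube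
        exp_add[symmetric] algebra_simps)
  finally have "\<bar>exp r - 1 - r\<bar> \<le> a\<^sup>2 * exp (3 * (1 + b)) / 2"
    unfolding e2 by simp
  moreover have "a\<^sup>2 / 2 \<le> a\<^sup>2 * exp (3 * (1 + b)) / 2"
    using b by (simp add: mult_le_cancel_left1)
  moreover have "0 \<le> a\<^sup>2 * exp (3 * (1 + b))" by simp
  ultimately show ?thesis
    using zero_le_power2[of a] unfolding r_def q by linarith
qed

lemma GDERIV_quadratic_remainder:
  fixes F :: "'a::euclidean_space \<Rightarrow> real"
  assumes "0 < r" and le: "\<And>h. norm h \<le> r \<Longrightarrow> \<bar>F (x + h) - F x - h \<bullet> D\<bar> \<le> K * (norm h)\<^sup>2"
  shows "GDERIV F x :> D"
  unfolding gderiv_def has_derivative_at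
proof (intro conjI)
  show "bounded_linear (\<lambda>h. h \<bullet> D)" by (rule bounded_linear_inner_left)
  have "((\<lambda>h. K * norm h) \<longlongrightarrow> 0) (at (0::'a))"
    by (auto intro!: tendsto_eq_intros)
  moreover have "\<forall>\<^sub>F h in at 0. norm (norm (F (x + h) - F x - h \<bullet> D) / norm h) \<le> K * norm h"
    unfolding eventually_at
  proof (intro exI[of _ r] conjI ballI impI)
    fix h :: 'a assume h: "h \<noteq> 0 \<and> dist h 0 < r"
    then have "\<bar>F (x + h) - F x - h \<bullet> D\<bar> \<le> (K * norm h) * norm h"
      using le[of h] by (simp add: power2_eq_square mult.assoc)
    then show "norm (norm (F (x + h) - F x - h \<bullet> D) / norm h) \<le> K * norm h"
      using h by (simp add: divide_le_eq)
  qed fact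
  ultimately show "(\<lambda>h. norm (F (x + h) - F x - h \<bullet> D) / norm h) \<midarrow>0\<rightarrow> 0"
    by (rule Lim_null_comparison[rotated])
qed

context
  fixes G :: "'a::euclidean_space \<Rightarrow> real" and L :: real
  assumes G: "L-lipschitz_on UNIV G"
begin

lemma lipschitz_nonneg: "0 \<le> L" using G by (rule lipschitz_on_nonneg)

lemma lipschitz_measurable [measurable]: "G \<in> borel_measurable borel"
  by (intro borel_measurable_continuous_onI lipschitz_on_continuous_on[OF G])

lemma lipschitz_diff_le: "\<bar>G x - G y\<bar> \<le> L * norm (x - y)"
  using lipschitz_on_normD[OF G, of x y] by simp

lemma lipschitz_linear_growth: "\<bar>G (x + \<mu> *\<^sub>R u)\<bar> \<le> \<bar>G x\<bar> + L * \<bar>\<mu>\<bar> * norm u"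
  using lipschitz_diff_le[of "x + \<mu> *\<^sub>R u" x] by (simp add: mult.assoc)

lemma integrable_gaussian_smoothing: "integrable std_gaussian (\<lambda>u. G (x + \<mu> *\<^sub>R u))"
proof (rule Bochner_Integration.integrable_bound)
  show "integrable std_gaussian (\<lambda>u. \<bar>G x\<bar> + L * \<bar>\<mu>\<bar> * norm (u::'a) ^ 1)"
    by (intro Bochner_Integration.integrable_add integrable_mult_right
        integrable_std_gaussian_norm_power) simp
  show "AE u in std_gaussian. norm (G (x + \<mu> *\<^sub>R u)) \<le> norm (\<bar>G x\<bar> + L * \<bar>\<mu>\<bar> * norm u ^ 1)"
    using lipschitz_linear_growth lipschitz_nonneg by (intro AE_I2) simp
qed measurable

lemma integrable_gaussian_smoothing_gradient:
  "integrable std_gaussian (\<lambda>u. G (x + \<mu> *\<^sub>R u) *\<^sub>R u)"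
proof (rule Bochner_Integration.integrable_bound)
  show "integrable std_gaussian (\<lambda>u. \<bar>G x\<bar> * norm (u::'a) ^ 1 + L * \<bar>\<mu>\<bar> * norm u ^ 2)"
    by (intro Bochner_Integration.integrable_add integrable_mult_right
        integrable_std_gaussian_norm_power)
  have "norm (G (x + \<mu> *\<^sub>R u) *\<^sub>R u) \<le> \<bar>G x\<bar> * norm u ^ 1 + L * \<bar>\<mu>\<bar> * norm u ^ 2" for u
    using mult_right_mono[OF lipschitz_linear_growth[of x \<mu> u] norm_ge_zero[of u]]
    by (simp add: algebra_simps power2_eq_square)
  then show "AE u in std_gaussian.
      norm (G (x + \<mu> *\<^sub>R u) *\<^sub>R u) \<le> norm (\<bar>G x\<bar> * norm u ^ 1 + L * \<bar>\<mu>\<bar> * norm u ^ 2)"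
    using lipschitz_nonneg by (intro AE_I2) simp
qed measurable

lemma inner_gaussian_smoothing_gradient:
  "gaussian_smoothing_gradient G x \<mu> \<bullet> w = (LINT u|std_gaussian. G (x + \<mu> *\<^sub>R u) * (u \<bullet> w)) / \<mu>"
  using integral_inner_left[of w std_gaussian "\<lambda>u. G (x + \<mu> *\<^sub>R u) *\<^sub>R u",
      OF integrable_gaussian_smoothing_gradient]
  by (simp add: gaussian_smoothing_gradient_def field_simps)

lemma integrable_gaussian_smoothing_gradient_inner:
  "integrable std_gaussian (\<lambda>u. G (x + \<mu> *\<^sub>R u) * (u \<bullet> w))"
  using integrable_inner_left[OF integrable_gaussian_smoothing_gradient[of x \<mu>], of w] by simp

text \<open>Moving \<open>x\<close> by \<open>h\<close> amounts to shifting the Gaussian variable by \<open>h / \<mu>\<close>.  After the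
  Cameron--Martin formula only the weight depends on \<open>h\<close>, and its expansion to first order
  gives the gradient, with a remainder \<open>O(\<parallel>h\<parallel>\<^sup>2)\<close>.\<close>

lemma GDERIV_gaussian_smoothing:
  assumes "0 < \<mu>"
  shows "GDERIV (\<lambda>y. gaussian_smoothing G y \<mu>) x :> gaussian_smoothing_gradient G x \<mu>"
proof (rule GDERIV_quadratic_remainder[OF assms])
  define C where "C = \<bar>G x\<bar> + L * \<mu>"
  let ?g = "\<lambda>u. G (x + \<mu> *\<^sub>R u)"
  let ?E = "\<lambda>u::'a. exp (4 * (1 + norm u))"
  have E: "integrable std_gaussian ?E"
    using integrable_std_gaussian_exp_norm[of 4, where 'a='a]
    by (simp add: ring_distribs exp_add)
  have C: "0 \<le> C" unfolding C_def using lipschitz_nonneg assms by simp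
  fix h :: 'a assume h: "norm h \<le> \<mu>"
  let ?a = "h /\<^sub>R \<mu>"
  let ?w = "\<lambda>u. exp (u \<bullet> ?a - (norm ?a)\<^sup>2 / 2)"
  let ?R = "\<lambda>u. ?g u * (?w u - 1 - u \<bullet> ?a)"
  have shift: "?g (u + ?a) = G (x + h + \<mu> *\<^sub>R u)" for u
    using assms by (simp add: algebra_simps)
  have iw: "integrable std_gaussian (\<lambda>u. ?w u * ?g u)"
    using integrable_std_gaussian_translate[of ?g ?a] integrable_gaussian_smoothing[of "x + h" \<mu>]
    unfolding shift by simp
  have "gaussian_smoothing G (x + h) \<mu> = (LINT u|std_gaussian. ?w u * ?g u)"
    using integral_std_gaussian_translate[of ?g ?a]
    unfolding shift gaussian_smoothing_def by simp
  moreover have "h \<bullet> gaussian_smoothing_gradient G x \<mu> = (LINT u|std_gaussian. ?g u * (u \<bullet> ?a))"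
    by (simp add: inner_commute[of h] inner_gaussian_smoothing_gradient divide_inverse
        mult.left_commute[of _ "inverse \<mu>"] mult.commute[of _ "inverse \<mu>"])
  moreover have "(LINT u|std_gaussian. ?R u)
      = (LINT u|std_gaussian. ?w u * ?g u) - (LINT u|std_gaussian. ?g u)
        - (LINT u|std_gaussian. ?g u * (u \<bullet> ?a))"
    using iw integrable_gaussian_smoothing[of x \<mu>]
      integrable_gaussian_smoothing_gradient_inner[of x \<mu> ?a]
    by (simp add: right_diff_distrib mult.commute)
  ultimately have rem: "gaussian_smoothing G (x + h) \<mu> - gaussian_smoothing G x \<mu>
      - h \<bullet> gaussian_smoothing_gradient G x \<mu> = (LINT u|std_gaussian. ?R u)"
    unfolding gaussian_smoothing_def by simp
  \<comment> \<open>Linear growth of \<open>G\<close> costs one factor \<open>exp (1 + norm u)\<close>,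
    the remainder of the weight three.\<close>
  have R: "\<bar>?R u\<bar> \<le> 2 * C * (norm ?a)\<^sup>2 * ?E u" for u
  proof -
    have "\<bar>?g u\<bar> \<le> \<bar>G x\<bar> + L * \<mu> * norm u"
      using lipschitz_linear_growth[of x \<mu> u] assms by simp
    also have "\<dots> \<le> C * (1 + norm u)"
      unfolding C_def using lipschitz_nonneg assms by (simp add: ring_distribs)
    also have "\<dots> \<le> C * exp (1 + norm u)"
      using C exp_ge_add_one_self[of "1 + norm u"] by (intro mult_left_mono) auto
    finally have g: "\<bar>?g u\<bar> \<le> C * exp (1 + norm u)" .
    have e: "\<bar>?w u - 1 - u \<bullet> ?a\<bar> \<le> 2 * (norm ?a)\<^sup>2 * exp (3 * (1 + norm u))"
    proof (rule exp_linear_remainder[OF _ refl])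
      show "\<bar>u \<bullet> ?a\<bar> \<le> norm ?a * norm u"
        using Cauchy_Schwarz_ineq2[of u ?a] by (simp only: mult.commute)
      show "norm ?a \<le> 1" using h assms by (simp add: field_simps)
    qed auto
    have "\<bar>?R u\<bar> \<le> (C * exp (1 + norm u)) * (2 * (norm ?a)\<^sup>2 * exp (3 * (1 + norm u)))"
      unfolding abs_mult using g e C by (intro mult_mono) auto
    also have "\<dots> = 2 * C * (norm ?a)\<^sup>2 * (exp (1 + norm u) * exp (3 * (1 + norm u)))"
      by (simp only: ac_simps)
    also have "exp (1 + norm u) * exp (3 * (1 + norm u)) = ?E u"
      by (simp add: exp_add[symmetric])
    finally show ?thesis .
  qed
  have "\<bar>LINT u|std_gaussian. ?R u\<bar> \<le> (LINT u|std_gaussian. 2 * C * (norm ?a)\<^sup>2 * ?E u)"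
    using R E C by (intro order_trans[OF integral_abs_bound] integral_mono')
      (auto intro!: Bochner_Integration.integrable_mult_right)
  also have "\<dots> = (2 * C * (LINT u|std_gaussian. ?E u) / \<mu>\<^sup>2) * (norm h)\<^sup>2"
    using assms by (simp add: power_mult_distrib power_inverse field_simps)
  finally show "\<bar>gaussian_smoothing G (x + h) \<mu> - gaussian_smoothing G x \<mu>
      - h \<bullet> gaussian_smoothing_gradient G x \<mu>\<bar>
      \<le> (2 * C * (LINT u|std_gaussian. ?E u) / \<mu>\<^sup>2) * (norm h)\<^sup>2"
    unfolding rem .
qed

text \<open>Testing the difference \<open>w\<close> of two gradients against itself leaves \<open>\<bar>u \<bullet> w\<bar>\<close> under the
  integral, whose mean is at most \<open>\<parallel>w\<parallel>\<close>; estimating by \<open>norm u\<close> instead would cost a factor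
  \<open>\<surd>d\<close>.\<close>

lemma lipschitz_gaussian_smoothing_gradient:
  assumes "0 < \<mu>"
  shows "(L / \<mu>)-lipschitz_on UNIV (\<lambda>x. gaussian_smoothing_gradient G x \<mu>)"
proof (rule lipschitz_onI)
  fix x y :: 'a
  define w where "w = gaussian_smoothing_gradient G x \<mu> - gaussian_smoothing_gradient G y \<mu>"
  let ?d = "\<lambda>u. G (x + \<mu> *\<^sub>R u) - G (y + \<mu> *\<^sub>R u)"
  have "w \<bullet> w = (LINT u|std_gaussian. ?d u * (u \<bullet> w)) / \<mu>"
    using integrable_gaussian_smoothing_gradient_inner
    by (subst (1) w_def)
       (simp add: inner_diff_left inner_gaussian_smoothing_gradient left_diff_distrib
        diff_divide_distrib)
  \<comment> \<open>Both integrals carry the same weight \<open>u\<close>, so the Lipschitz bound of \<open>G\<close> applies inside.\<close>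
  also have "\<dots> \<le> (LINT u|std_gaussian. (L * norm (x - y)) * \<bar>u \<bullet> w\<bar>) / \<mu>"
  proof (intro divide_right_mono integral_mono)
    show "integrable std_gaussian (\<lambda>u. ?d u * (u \<bullet> w))"
      using integrable_gaussian_smoothing_gradient_inner by (simp add: left_diff_distrib)
    have "integrable std_gaussian (\<lambda>u. u \<bullet> w)"
      using std_gaussian.square_integrable_imp_integrable[OF _ integrable_std_gaussian_inner_square]
      by simp
    then show "integrable std_gaussian (\<lambda>u. (L * norm (x - y)) * \<bar>u \<bullet> w\<bar>)" by simp
    show "?d u * (u \<bullet> w) \<le> (L * norm (x - y)) * \<bar>u \<bullet> w\<bar>" for u
    proof -
      have "?d u * (u \<bullet> w) \<le> \<bar>?d u\<bar> * \<bar>u \<bullet> w\<bar>" by (metis abs_ge_self abs_mult)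
      also have "\<dots> \<le> (L * norm (x - y)) * \<bar>u \<bullet> w\<bar>"
        using lipschitz_diff_le[of "x + \<mu> *\<^sub>R u" "y + \<mu> *\<^sub>R u"] by (intro mult_right_mono) auto
      finally show ?thesis .
    qed
  qed (use assms in auto)
  also have "\<dots> \<le> (L * norm (x - y)) * norm w / \<mu>"
    using std_gaussian_abs_inner_le[of w] lipschitz_nonneg assms
    by (auto intro!: divide_right_mono mult_left_mono)
  finally have "norm w * norm w \<le> (L / \<mu> * norm (x - y)) * norm w"
    by (simp add: power2_norm_eq_inner[symmetric] power2_eq_square)
  then have "norm w \<le> L / \<mu> * norm (x - y)"
    by (cases "w = 0") (use lipschitz_nonneg assms in simp, rule mult_right_le_imp_le, auto)
  then show "dist (gaussian_smoothing_gradient G x \<mu>) (gaussian_smoothing_gradient G y \<mu>)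
      \<le> L / \<mu> * dist x y"
    by (simp add: w_def dist_norm)
qed (use lipschitz_nonneg assms in simp)

text \<open>A joint Lipschitz bound in the point and the smoothing parameter.  As \<open>\<nu> = 0\<close> gives \<open>G\<close>
  itself, it covers both the convergence of the smoothing and its Lipschitz dependence on
  the parameter.\<close>

lemma gaussian_smoothing_diff_le:
  "\<bar>gaussian_smoothing G x \<mu> - gaussian_smoothing G y \<nu>\<bar>
    \<le> L * norm (x - y) + L * sqrt (real DIM('a)) * \<bar>\<mu> - \<nu>\<bar>"
proof -
  let ?B = "\<lambda>u::'a. L * norm (x - y) + L * \<bar>\<mu> - \<nu>\<bar> * norm u"
  have n: "integrable std_gaussian (\<lambda>u::'a. norm u)"
    using integrable_std_gaussian_norm_power[of 1] by simp
  have "\<bar>gaussian_smoothing G x \<mu> - gaussian_smoothing G y \<nu>\<bar>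
      = \<bar>LINT u|std_gaussian. G (x + \<mu> *\<^sub>R u) - G (y + \<nu> *\<^sub>R u)\<bar>"
    unfolding gaussian_smoothing_def by (simp add: integrable_gaussian_smoothing)
  also have "\<dots> \<le> (LINT u|std_gaussian. ?B u)"
  proof (rule order_trans[OF integral_abs_bound integral_mono'])
    show "integrable std_gaussian ?B" using n by simp
    show "\<bar>G (x + \<mu> *\<^sub>R u) - G (y + \<nu> *\<^sub>R u)\<bar> \<le> ?B u" for u
    proof -
      have "(x + \<mu> *\<^sub>R u) - (y + \<nu> *\<^sub>R u) = (x - y) + (\<mu> - \<nu>) *\<^sub>R u" by (simp add: algebra_simps)
      then have "norm ((x + \<mu> *\<^sub>R u) - (y + \<nu> *\<^sub>R u)) \<le> norm (x - y) + \<bar>\<mu> - \<nu>\<bar> * norm u"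
        by (metis norm_scaleR norm_triangle_ineq)
      from mult_left_mono[OF this lipschitz_nonneg] show ?thesis
        using lipschitz_diff_le[of "x + \<mu> *\<^sub>R u" "y + \<nu> *\<^sub>R u"] by (simp add: algebra_simps)
    qed
  qed (use lipschitz_nonneg in auto)
  also have "\<dots> = L * norm (x - y) + L * \<bar>\<mu> - \<nu>\<bar> * (LINT u|std_gaussian. norm (u::'a))"
    using n std_gaussian.prob_space[where 'a='a] by simp
  also have "\<dots> \<le> L * norm (x - y) + L * \<bar>\<mu> - \<nu>\<bar> * sqrt (real DIM('a))"
    using std_gaussian_norm_le[where 'a='a] lipschitz_nonneg by (intro add_left_mono mult_left_mono) auto
  finally show ?thesis by (simp add: ac_simps)
qed

lemma gaussian_smoothing_0: "gaussian_smoothing G x 0 = G x"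
  using std_gaussian.prob_space[where 'a='a] by (simp add: gaussian_smoothing_def)

lemma convex_gaussian_smoothing:
  assumes "convex_on UNIV G"
  shows "convex_on UNIV (\<lambda>x. gaussian_smoothing G x \<mu>)"
proof (rule convex_onI)
  fix t :: real and x y :: 'a assume t: "0 < t" "t < 1"
  let ?z = "(1 - t) *\<^sub>R x + t *\<^sub>R y"
  have "gaussian_smoothing G ?z \<mu>
      \<le> (LINT u|std_gaussian. (1 - t) * G (x + \<mu> *\<^sub>R u) + t * G (y + \<mu> *\<^sub>R u))"
    unfolding gaussian_smoothing_def
  proof (rule integral_mono)
    show "G (?z + \<mu> *\<^sub>R u) \<le> (1 - t) * G (x + \<mu> *\<^sub>R u) + t * G (y + \<mu> *\<^sub>R u)" for u
      using convex_onD[OF assms, of t "x + \<mu> *\<^sub>R u" "y + \<mu> *\<^sub>R u"] t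
      by (simp add: algebra_simps)
  qed (simp_all add: integrable_gaussian_smoothing)
  also have "\<dots> = (1 - t) * gaussian_smoothing G x \<mu> + t * gaussian_smoothing G y \<mu>"
    unfolding gaussian_smoothing_def by (simp add: integrable_gaussian_smoothing)
  finally show "gaussian_smoothing G ?z \<mu>
      \<le> (1 - t) * gaussian_smoothing G x \<mu> + t * gaussian_smoothing G y \<mu>" .
qed simp

end

text \<open>Only the values of \<open>c\<close> on \<open>X\<close> and of \<open>D\<close> at positive parameters are tied to \<open>G\<close>, because a
  random Lipschitz function averages to a Lipschitz function on the whole space even if the
  given objective is known on \<open>X\<close> alone.\<close>

lemma smoothing_function_gaussian_smoothing:
  fixes G :: "'a::euclidean_space \<Rightarrow> real"
  assumes G: "L-lipschitz_on UNIV G" and cvx: "convex_on UNIV G" and "0 < L" and X: "convex X"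
    and c: "\<And>x. x \<in> X \<Longrightarrow> c x = G x"
    and D: "\<And>x \<mu>. 0 < \<mu> \<Longrightarrow> D x \<mu> = gaussian_smoothing_gradient G x \<mu>"
  shows "smoothing_function X \<mu>b c (gaussian_smoothing G) D (L * sqrt (real DIM('a))) 0 L"
  unfolding smoothing_function_def
proof (intro conjI ballI)
  have "convex_on X G" using cvx by (rule convex_on_subset) (simp_all add: X)
  then show "convex_on X c" using c convexD[OF X] by (simp add: convex_on_def)
  show "0 < L * sqrt (real DIM('a))" using \<open>0 < L\<close> by simp
next
  fix \<mu> assume \<mu>: "\<mu> \<in> {0<..\<mu>b}"
  then have D\<mu>: "(\<lambda>x. D x \<mu>) = (\<lambda>x. gaussian_smoothing_gradient G x \<mu>)" using D by auto
  show "has_gradient_on (\<lambda>x. gaussian_smoothing G x \<mu>) (\<lambda>x. D x \<mu>) X"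
    unfolding D\<mu> has_gradient_on_def
    using GDERIV_gaussian_smoothing[OF G] \<mu>
    by (auto simp: gderiv_def intro: has_derivative_at_withinI)
  have lip: "(L / \<mu>)-lipschitz_on UNIV (\<lambda>x. D x \<mu>)"
    unfolding D\<mu> using \<mu> by (intro lipschitz_gaussian_smoothing_gradient[OF G]) simp
  then show "(0 + L / \<mu>)-lipschitz_on X (\<lambda>x. D x \<mu>)"
    using lipschitz_on_subset[OF lip, of X] by simp
  then show "continuous_on X (\<lambda>x. D x \<mu>)" by (rule lipschitz_on_continuous_on)
  show "convex_on X (\<lambda>x. gaussian_smoothing G x \<mu>)"
    using convex_gaussian_smoothing[OF G cvx] by (rule convex_on_subset) (simp_all add: X)
next
  fix x assume x: "x \<in> X"
  let ?B = "\<lambda>p. L * norm (fst p - x) + L * sqrt (real DIM('a)) * \<bar>snd p - 0\<bar>"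
  let ?at = "at (x, 0::real) within X \<times> {0<..\<mu>b}"
  have "((\<lambda>p. (case p of (z, \<mu>) \<Rightarrow> gaussian_smoothing G z \<mu>) - c x) \<longlongrightarrow> 0) ?at"
  proof (rule Lim_null_comparison)
    show "\<forall>\<^sub>F p in ?at. norm ((case p of (z, \<mu>) \<Rightarrow> gaussian_smoothing G z \<mu>) - c x) \<le> ?B p"
    proof (intro always_eventually allI)
      fix p :: "'a \<times> real"
      show "norm ((case p of (z, \<mu>) \<Rightarrow> gaussian_smoothing G z \<mu>) - c x) \<le> ?B p"
        using gaussian_smoothing_diff_le[OF G, of "fst p" "snd p" x 0]
        by (simp add: case_prod_beta c[OF x] gaussian_smoothing_0[OF G])
    qed
    have "(?B \<longlongrightarrow> ?B (x, 0)) ?at" by (intro tendsto_intros)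
    then show "(?B \<longlongrightarrow> 0) ?at" by simp
  qed
  then show "((\<lambda>(z, \<mu>). gaussian_smoothing G z \<mu>) \<longlongrightarrow> c x) ?at"
    by (rule LIM_zero_cancel)
next
  fix x \<mu>1 \<mu>2
  show "\<bar>gaussian_smoothing G x \<mu>2 - gaussian_smoothing G x \<mu>1\<bar>
      \<le> L * sqrt (real DIM('a)) * \<bar>\<mu>1 - \<mu>2\<bar>"
    using gaussian_smoothing_diff_le[OF G, of x \<mu>2 x \<mu>1] by (simp add: abs_minus_commute)
qed (use \<open>0 < L\<close> in simp)

section \<open>Gradients and subgradients\<close>

lemma GDERIV_unique:
  assumes "GDERIV F x :> D" "GDERIV F x :> E"
  shows "D = E"
proof -
  have "(\<lambda>h. h \<bullet> D) = (\<lambda>h. h \<bullet> E)"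
    using assms unfolding gderiv_def by (rule has_derivative_unique)
  then have "(D - E) \<bullet> D = (D - E) \<bullet> E" by (rule fun_cong)
  then have "(D - E) \<bullet> (D - E) = 0" by (simp only: inner_diff_right)
  then show ?thesis by simp
qed

lemma grad_eq: "GDERIV F x :> D \<Longrightarrow> grad F x = D"
  unfolding grad_def by (blast intro: GDERIV_unique)

text \<open>Subtracting the linear function \<open>y \<mapsto> e \<bullet> (y - x)\<close> leaves a function with a global minimum
  at \<open>x\<close>, so its derivative \<open>D - e\<close> vanishes there.\<close>

lemma GDERIV_subgradient_unique:
  fixes F :: "'a::euclidean_space \<Rightarrow> real"
  assumes F: "GDERIV F x :> D" and sub: "\<And>y. F x + e \<bullet> (y - x) \<le> F y"
  shows "e = D"
proof -
  let ?\<phi> = "\<lambda>y. F y - e \<bullet> (y - x)"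
  have "(?\<phi> has_derivative (\<lambda>h. h \<bullet> D - e \<bullet> (h - 0))) (at x)"
    using F unfolding gderiv_def
    by (intro has_derivative_diff has_derivative_inner_right has_derivative_ident
        has_derivative_const)
  then have "(\<lambda>h. h \<bullet> D - e \<bullet> (h - 0)) = (\<lambda>h. 0)"
    by (rule differential_zero_maxmin[of x UNIV, OF UNIV_I open_UNIV])
       (use sub in \<open>auto simp: algebra_simps\<close>)
  then have "(D - e) \<bullet> D - e \<bullet> ((D - e) - 0) = 0" by (rule fun_cong)
  then have "(D - e) \<bullet> (D - e) = 0" by (simp add: inner_diff_right inner_commute inner_diff_left)
  then show ?thesis by simp
qed

lemma subgradient_real_le:
  assumes fin: "\<And>x. \<bar>F x\<bar> \<noteq> \<infinity>" and g: "g \<in> subdifferential F x"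
  shows "real_of_ereal (F x) + g \<bullet> (y - x) \<le> real_of_ereal (F y)"
proof -
  have "ereal (real_of_ereal (F x)) + ereal (g \<bullet> (y - x)) \<le> ereal (real_of_ereal (F y))"
    using g fin unfolding subdifferential_def by (simp add: ereal_real')
  then show ?thesis by simp
qed

text \<open>Moving from \<open>x\<close> in the direction \<open>g\<close> itself, the function rises by at least \<open>\<parallel>g\<parallel>\<^sup>2\<close> but by
  at most \<open>L \<parallel>g\<parallel>\<close>.\<close>

lemma subgradient_norm_le:
  assumes lip: "ereal_lipschitz L F" and g: "g \<in> subdifferential F x"
  shows "norm g \<le> L"
proof -
  let ?F = "\<lambda>x. real_of_ereal (F x)"
  have "?F x + g \<bullet> ((x + g) - x) \<le> ?F (x + g)"
    by (rule subgradient_real_le[OF _ g]) (use lip in \<open>simp add: ereal_lipschitz_def\<close>)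
  moreover have "\<bar>?F (x + g) - ?F x\<bar> \<le> L * norm g"
    using lip lipschitz_on_normD[of L UNIV ?F "x + g" x] by (simp add: ereal_lipschitz_def)
  ultimately have "norm g * norm g \<le> L * norm g"
    by (simp add: power2_norm_eq_inner[symmetric] power2_eq_square)
  moreover have "0 \<le> L" using lip lipschitz_on_nonneg unfolding ereal_lipschitz_def by blast
  ultimately show ?thesis by (cases "g = 0") auto
qed

lemma closed_proper_convex_imp_convex_on:
  assumes cpc: "closed_proper_convex F" and fin: "\<And>x. \<bar>F x\<bar> \<noteq> \<infinity>"
  shows "convex_on UNIV (\<lambda>x. real_of_ereal (F x))"
proof (rule convex_onI)
  let ?F = "\<lambda>x. real_of_ereal (F x)"
  fix t :: real and x y assume t: "0 < t" "t < 1"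
  have eq: "F y = ereal (?F y)" for y
    using fin by (simp add: ereal_real')
  have "(x, ?F x) \<in> ereal_epigraph F" "(y, ?F y) \<in> ereal_epigraph F"
    using fin by (auto simp: ereal_epigraph_def ereal_real')
  then have "(1 - t) *\<^sub>R (x, ?F x) + t *\<^sub>R (y, ?F y) \<in> ereal_epigraph F"
    using cpc t unfolding closed_proper_convex_def by (intro convexD) auto
  then have "F ((1 - t) *\<^sub>R x + t *\<^sub>R y) \<le> ereal ((1 - t) * ?F x + t * ?F y)"
    by (simp add: ereal_epigraph_def)
  then show "?F ((1 - t) *\<^sub>R x + t *\<^sub>R y) \<le> (1 - t) * ?F x + t * ?F y"
    using eq by (metis ereal_less_eq(3))
qed simp

section \<open>Supports, independence and variance of random vectors\<close>

text \<open>Every point outside the support has a null neighbourhood, and by the Lindeloef property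
  countably many of these cover the complement.\<close>

lemma (in finite_measure) AE_in_rv_support:
  assumes [measurable]: "Y \<in> borel_measurable M"
  shows "AE \<omega> in M. Y \<omega> \<in> rv_support M Y"
proof -
  let ?\<U> = "{U. open U \<and> measure M {\<omega> \<in> space M. Y \<omega> \<in> U} = 0}"
  obtain \<V> where \<V>: "\<V> \<subseteq> ?\<U>" "countable \<V>" "\<Union>\<V> = \<Union>?\<U>"
    by (rule Lindelof[of ?\<U>]) auto
  have "AE \<omega> in M. Y \<omega> \<notin> U" if "U \<in> \<V>" for U
  proof -
    have [measurable]: "U \<in> sets borel" using that \<V>(1) by auto
    have "emeasure M {\<omega> \<in> space M. Y \<omega> \<in> U} = 0"
      using that \<V>(1) by (auto simp: emeasure_eq_measure)
    then show ?thesis by (subst AE_iff_measurable[OF _ refl]) auto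
  qed
  then have "AE \<omega> in M. \<forall>U\<in>\<V>. Y \<omega> \<notin> U"
    by (simp add: AE_ball_countable[OF \<V>(2)])
  moreover have "- rv_support M Y \<subseteq> \<Union>\<V>"
    unfolding \<V>(3) rv_support_def by (auto simp: not_less measure_le_0_iff)
  ultimately show ?thesis
    by (elim eventually_mono) blast
qed

text \<open>The two variables may take values in different types, which is why independence is
  expressed through the two families of preimages.\<close>

lemma (in prob_space) distr_pair_eq_of_indep_set:
  assumes Y [measurable]: "Y \<in> measurable M S" and Z [measurable]: "Z \<in> measurable M T"
    and ind: "indep_set {Y -` A \<inter> space M |A. A \<in> sets S} {Z -` B \<inter> space M |B. B \<in> sets T}"
  shows "distr M S Y \<Otimes>\<^sub>M distr M T Z = distr M (S \<Otimes>\<^sub>M T) (\<lambda>\<omega>. (Y \<omega>, Z \<omega>))"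
proof (rule pair_measure_eqI)
  show "sigma_finite_measure (distr M S Y)" "sigma_finite_measure (distr M T Z)"
    by (intro prob_space_imp_sigma_finite prob_space_distr Y Z)+
  show "sets (distr M S Y \<Otimes>\<^sub>M distr M T Z) = sets (distr M (S \<Otimes>\<^sub>M T) (\<lambda>\<omega>. (Y \<omega>, Z \<omega>)))"
    by (simp cong: sets_pair_measure_cong)
  fix A B assume "A \<in> sets (distr M S Y)" "B \<in> sets (distr M T Z)"
  then have A [measurable]: "A \<in> sets S" and B [measurable]: "B \<in> sets T" by auto
  have "prob ((Y -` A \<inter> space M) \<inter> (Z -` B \<inter> space M))
      = prob (Y -` A \<inter> space M) * prob (Z -` B \<inter> space M)"
    by (rule indep_setD[OF ind]) (use A B in auto)
  moreover have "(Y -` A \<inter> space M) \<inter> (Z -` B \<inter> space M)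
      = (\<lambda>\<omega>. (Y \<omega>, Z \<omega>)) -` (A \<times> B) \<inter> space M"
    by auto
  ultimately show "emeasure (distr M S Y) A * emeasure (distr M T Z) B
      = emeasure (distr M (S \<Otimes>\<^sub>M T) (\<lambda>\<omega>. (Y \<omega>, Z \<omega>))) (A \<times> B)"
    by (simp add: emeasure_distr emeasure_eq_measure ennreal_mult)
qed

text \<open>Fubini's theorem for the product of the two laws, with the inner integral kept on the
  original probability space: properties that hold almost surely there need not describe a
  measurable set of values of \<open>Y\<close>.\<close>

lemma (in prob_space) expectation_indep_iterated:
  fixes k :: "'b \<times> 'c \<Rightarrow> 'd::{banach, second_countable_topology}"
  assumes Y: "Y \<in> measurable M S" and Z: "Z \<in> measurable M T"
    and ind: "indep_set {Y -` A \<inter> space M |A. A \<in> sets S} {Z -` B \<inter> space M |B. B \<in> sets T}"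
    and k: "k \<in> borel_measurable (S \<Otimes>\<^sub>M T)" and int: "integrable M (\<lambda>\<omega>. k (Y \<omega>, Z \<omega>))"
  shows "expectation (\<lambda>\<omega>. k (Y \<omega>, Z \<omega>)) = (LINT z|distr M T Z. expectation (\<lambda>\<omega>. k (Y \<omega>, z)))"
proof -
  note law = distr_pair_eq_of_indep_set[OF Y Z ind]
  have YZ: "(\<lambda>\<omega>. (Y \<omega>, Z \<omega>)) \<in> measurable M (S \<Otimes>\<^sub>M T)" using Y Z by simp
  interpret P: pair_sigma_finite "distr M S Y" "distr M T Z"
    unfolding pair_sigma_finite_def
    by (intro conjI prob_space_imp_sigma_finite prob_space_distr Y Z)
  have "integrable (distr M S Y \<Otimes>\<^sub>M distr M T Z) k"
    unfolding law using int YZ k by (simp add: integrable_distr_eq)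
  then have "(LINT z|distr M T Z. LINT y|distr M S Y. k (y, z))
      = integral\<^sup>L (distr M S Y \<Otimes>\<^sub>M distr M T Z) k"
    using P.integral_snd[of "\<lambda>y z. k (y, z)"] by (simp add: case_prod_unfold)
  also have "\<dots> = expectation (\<lambda>\<omega>. k (Y \<omega>, Z \<omega>))"
    unfolding law using YZ k by (rule integral_distr)
  also have "(LINT z|distr M T Z. LINT y|distr M S Y. k (y, z))
      = (LINT z|distr M T Z. expectation (\<lambda>\<omega>. k (Y \<omega>, z)))"
  proof (rule Bochner_Integration.integral_cong[OF refl])
    fix z assume "z \<in> space (distr M T Z)"
    then have "(\<lambda>y. k (y, z)) \<in> borel_measurable S" 
      using measurable_compose[OF measurable_Pair2' k] by simp
    then show "(LINT y|distr M S Y. k (y, z)) = expectation (\<lambda>\<omega>. k (Y \<omega>, z))"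
      using Y by (simp add: integral_distr)
  qed
  finally show ?thesis by simp
qed

text \<open>Expanding the square about the mean shows that the variance is at most the second moment.\<close>

lemma (in prob_space) variance_vec_le:
  fixes Z :: "'a \<Rightarrow> 'c::euclidean_space"
  assumes [measurable]: "Z \<in> borel_measurable M" and bnd: "AE \<omega> in M. norm (Z \<omega>) \<le> L"
  shows "integrable M (\<lambda>\<omega>. (norm (Z \<omega> - expectation Z))\<^sup>2)" (is ?I)
    and "expectation (\<lambda>\<omega>. (norm (Z \<omega> - expectation Z))\<^sup>2) \<le> L\<^sup>2" (is ?V)
proof -
  let ?m = "expectation Z"
  have Z: "integrable M Z" by (rule integrable_const_bound[OF bnd]) simp
  have b2: "AE \<omega> in M. (norm (Z \<omega>))\<^sup>2 \<le> L\<^sup>2"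
    using bnd by eventually_elim (auto intro: power_mono)
  have Z2: "integrable M (\<lambda>\<omega>. (norm (Z \<omega>))\<^sup>2)"
    by (rule integrable_const_bound[where B = "L\<^sup>2"]) (use b2 in auto)
  have eq: "(norm (Z \<omega> - ?m))\<^sup>2 = (norm (Z \<omega>))\<^sup>2 - 2 * (Z \<omega> \<bullet> ?m) + (norm ?m)\<^sup>2" for \<omega>
    by (simp add: power2_norm_eq_inner inner_diff_left inner_diff_right inner_commute)
  show ?I unfolding eq using Z Z2 by simp
  have "expectation (\<lambda>\<omega>. (norm (Z \<omega> - ?m))\<^sup>2)
      = expectation (\<lambda>\<omega>. (norm (Z \<omega>))\<^sup>2) - 2 * (?m \<bullet> ?m) + (norm ?m)\<^sup>2"
    unfolding eq using Z Z2 prob_space by simp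
  also have "\<dots> \<le> expectation (\<lambda>\<omega>. (norm (Z \<omega>))\<^sup>2)"
    by (simp add: power2_norm_eq_inner)
  also have "\<dots> \<le> L\<^sup>2"
    using integral_mono_AE[OF Z2 _ b2] prob_space by simp
  finally show ?V .
qed

section \<open>Smoothing an expectation of convex Lipschitz functions\<close>

theorem lemma3:
  fixes M :: "'w measure"
    and \<xi> :: "'w \<Rightarrow> 'b::euclidean_space"
    and v :: "'w \<Rightarrow> 'a::euclidean_space"
    and X :: "'a set"
    and \<Xi> :: "'b set"
    and H :: "'a \<Rightarrow> 'b \<Rightarrow> ereal"
    and f h :: "'a \<Rightarrow> real"
    and Df :: "'a \<Rightarrow> 'a"
    and h\<^sub>s :: "'a \<Rightarrow> real \<Rightarrow> real"
    and Dh\<^sub>s :: "'a \<Rightarrow> real \<Rightarrow> 'a"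
    and g :: "'a \<Rightarrow> real \<Rightarrow> 'b \<times> 'a \<Rightarrow> 'a"
    and L0 Lf \<mu>b :: real
  assumes "prob_space M"
    and "closed X" and "convex X"
    and "0 < \<mu>b" and "0 < L0"
    and \<Xi>_def: "\<Xi> = rv_support M \<xi>"
    and \<xi>_measurable: "\<xi> \<in> borel_measurable M"
    and indep: "prob_space.indep_set M {\<xi> -` A \<inter> space M |A. A \<in> sets borel}
                                      {v -` B \<inter> space M |B. B \<in> sets borel}"
    and gaussian: "distributed M lborel v (\<lambda>x. ennreal (std_gaussian_density x))"
    and H_measurable: "(\<lambda>(y, s). H y s) \<in> borel_measurable (borel \<Otimes>\<^sub>M borel)"
    and H_convex: "\<And>s. s \<in> \<Xi> \<Longrightarrow> closed_proper_convex (\<lambda>y. H y s)"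
    and H_lipschitz: "AE \<omega> in M. ereal_lipschitz L0 (\<lambda>y. H y (\<xi> \<omega>))"
    and h_finite: "\<And>x. x \<in> X \<Longrightarrow> integrable M (\<lambda>\<omega>. real_of_ereal (H x (\<xi> \<omega>)))"
    and h_def: "\<And>x. x \<in> X \<Longrightarrow> h x = (LINT \<omega>|M. real_of_ereal (H x (\<xi> \<omega>)))"
    and h_continuous: "continuous_on X h"
    and f_convex: "convex_on X f"
    and f_gradient: "has_gradient_on f Df X"
    and f_smooth: "Lf-lipschitz_on X Df"
    and h\<^sub>s_def: "\<And>x \<mu>. h\<^sub>s x \<mu> = (LINT \<omega>|M. real_of_ereal (H (x + \<mu> *\<^sub>R v \<omega>) (\<xi> \<omega>)))"
    and Dh\<^sub>s_def: "\<And>x \<mu>. Dh\<^sub>s x \<mu> = grad (\<lambda>y. h\<^sub>s y \<mu>) x"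
    and g_measurable: "\<And>x \<mu>. x \<in> X \<Longrightarrow> \<mu> \<in> {0<..\<mu>b} \<Longrightarrow> g x \<mu> \<in> borel_measurable (borel \<Otimes>\<^sub>M borel)"
    and g_subgradient: "\<And>x \<mu>. x \<in> X \<Longrightarrow> \<mu> \<in> {0<..\<mu>b} \<Longrightarrow>
          AE \<omega> in M. g x \<mu> (\<xi> \<omega>, v \<omega>) \<in> subdifferential (\<lambda>y. H y (\<xi> \<omega>)) (x + \<mu> *\<^sub>R v \<omega>)"
  shows "(\<forall>x\<in>X. \<forall>\<mu>\<in>{0<..\<mu>b}.
            integrable M (\<lambda>\<omega>. real_of_ereal (H (x + \<mu> *\<^sub>R v \<omega>) (\<xi> \<omega>))) \<and>
            GDERIV (\<lambda>y. h\<^sub>s y \<mu>) x :> Dh\<^sub>s x \<mu>) \<and>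
         smoothing_function X \<mu>b h h\<^sub>s Dh\<^sub>s (L0 * sqrt (real DIM('a))) 0 L0 \<and>
         (\<forall>\<mu>\<in>{0<..\<mu>b}. has_gradient_on (\<lambda>x. f x + h\<^sub>s x \<mu>) (\<lambda>x. Df x + Dh\<^sub>s x \<mu>) X) \<and>
         unbiased_bounded_variance M (\<lambda>\<omega>. (\<xi> \<omega>, v \<omega>)) X \<mu>b
           (\<lambda>x \<mu>. Df x + Dh\<^sub>s x \<mu>) (\<lambda>x \<mu> \<zeta>. Df x + g x \<mu> \<zeta>) (L0\<^sup>2)"
proof (cases "X = {}")
  case True
  then show ?thesis
    using \<open>0 < L0\<close> \<open>convex X\<close>
    by (simp add: smoothing_function_def has_gradient_on_def unbiased_bounded_variance_def
        convex_on_def lipschitz_on_def)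
next
  case False
  then obtain x0 where x0: "x0 \<in> X" by blast
  interpret prob_space M by fact
  note [measurable] = \<xi>_measurable
  have v [measurable]: "v \<in> borel_measurable M"
    using distributed_measurable[OF gaussian] by simp
  have v_law: "distr M borel v = std_gaussian"
    using distributed_distr_eq_density[OF gaussian]
    by (simp add: std_gaussian_def cong: distr_cong)

  define F where "F y \<omega> = real_of_ereal (H y (\<xi> \<omega>))" for y \<omega>
  \<comment> \<open>\<open>G\<close> extends \<open>h\<close> from \<open>X\<close> to the whole space.\<close>
  define G where "G y = expectation (F y)" for y

  have F_lip: "AE \<omega> in M. L0-lipschitz_on UNIV (\<lambda>y. F y \<omega>)"
    using H_lipschitz unfolding F_def ereal_lipschitz_def by eventually_elim blast
  have F_convex: "AE \<omega> in M. convex_on UNIV (\<lambda>y. F y \<omega>)"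
    using AE_in_rv_support[OF \<xi>_measurable] H_lipschitz
  proof eventually_elim
    case (elim \<omega>)
    then show ?case
      unfolding F_def ereal_lipschitz_def
      by (intro closed_proper_convex_imp_convex_on H_convex) (auto simp: \<Xi>_def)
  qed
  have F_measurable: "(\<lambda>\<omega>. F (Y \<omega>) \<omega>) \<in> borel_measurable M"
    if [measurable]: "Y \<in> borel_measurable M" for Y
  proof -
    have "(\<lambda>\<omega>. (Y \<omega>, \<xi> \<omega>)) \<in> measurable M (borel \<Otimes>\<^sub>M borel)" by measurable
    from measurable_compose[OF this H_measurable] show ?thesis
      unfolding F_def by (intro borel_measurable_real_of_ereal) simp
  qed
  \<comment> \<open>By the Lipschitz condition, integrability at the one point \<open>x0\<close> of \<open>X\<close> propagates to every
    integrable argument, random ones included.\<close>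
  have F_integrable: "integrable M (\<lambda>\<omega>. F (Y \<omega>) \<omega>)" if Y: "integrable M Y" for Y
  proof (rule Bochner_Integration.integrable_bound)
    show "integrable M (\<lambda>\<omega>. norm (F x0 \<omega>) + L0 * norm (Y \<omega> - x0))"
    proof -
      have "integrable M (F x0)" using h_finite[OF x0] by (simp add: F_def[abs_def])
      then show ?thesis using Y by simp
    qed
    show "AE \<omega> in M. norm (F (Y \<omega>) \<omega>) \<le> norm (norm (F x0 \<omega>) + L0 * norm (Y \<omega> - x0))"
      using F_lip
    proof eventually_elim
      case (elim \<omega>)
      then show ?case
        using lipschitz_on_normD[OF elim, of "Y \<omega>" x0] \<open>0 < L0\<close> by simp
    qed
  qed (use Y F_measurable in auto)

  have G_lip: "L0-lipschitz_on UNIV G"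
  proof (rule lipschitz_onI)
    fix x y
    have "\<bar>G x - G y\<bar> = \<bar>expectation (\<lambda>\<omega>. F x \<omega> - F y \<omega>)\<bar>"
      unfolding G_def using F_integrable[of "\<lambda>_. x"] F_integrable[of "\<lambda>_. y"] by simp
    also have "\<dots> \<le> expectation (\<lambda>\<omega>. \<bar>F x \<omega> - F y \<omega>\<bar>)" by (rule integral_abs_bound)
    also have "\<dots> \<le> expectation (\<lambda>\<omega>. L0 * norm (x - y))"
    proof (rule integral_mono_AE)
      show "AE \<omega> in M. \<bar>F x \<omega> - F y \<omega>\<bar> \<le> L0 * norm (x - y)"
        using F_lip by eventually_elim (use lipschitz_on_normD in fastforce)
    qed (use F_integrable[of "\<lambda>_. x"] F_integrable[of "\<lambda>_. y"] in simp_all)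
    finally show "dist (G x) (G y) \<le> L0 * dist x y"
      using prob_space by (simp add: dist_norm)
  qed (use \<open>0 < L0\<close> in simp)
  have G_convex: "convex_on UNIV G"
  proof (rule convex_onI)
    fix t :: real and x y :: 'a assume t: "0 < t" "t < 1"
    have i: "integrable M (F z)" for z using F_integrable[of "\<lambda>_. z"] by simp
    have "G ((1 - t) *\<^sub>R x + t *\<^sub>R y) \<le> expectation (\<lambda>\<omega>. (1 - t) * F x \<omega> + t * F y \<omega>)"
      unfolding G_def
    proof (rule integral_mono_AE)
      show "AE \<omega> in M. F ((1 - t) *\<^sub>R x + t *\<^sub>R y) \<omega> \<le> (1 - t) * F x \<omega> + t * F y \<omega>"
        using F_convex by eventually_elim (use t in \<open>auto intro: convex_onD\<close>)
    qed (use i in auto)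
    also have "\<dots> = (1 - t) * G x + t * G y" unfolding G_def using i by simp
    finally show "G ((1 - t) *\<^sub>R x + t *\<^sub>R y) \<le> (1 - t) * G x + t * G y" .
  qed simp

  have v_integrable: "integrable M v"
  proof -
    have "integrable std_gaussian (\<lambda>u::'a. norm u)"
      using integrable_std_gaussian_norm_power[of 1] by simp
    then show ?thesis
      unfolding v_law[symmetric] by (simp add: integrable_distr_eq integrable_norm_iff)
  qed
  have Fv_integrable: "integrable M (\<lambda>\<omega>. F (x + \<mu> *\<^sub>R v \<omega>) \<omega>)" for x \<mu>
    by (rule F_integrable) (use v_integrable in simp)
  \<comment> \<open>Averaging over \<open>\<xi>\<close> first turns the smoothing into one of a deterministic function.\<close>
  have h\<^sub>s_eq: "h\<^sub>s = gaussian_smoothing G"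
  proof (intro ext)
    fix x \<mu>
    let ?k = "\<lambda>(s, u). real_of_ereal (H (x + \<mu> *\<^sub>R u) s)"
    have k: "?k \<in> borel_measurable (borel \<Otimes>\<^sub>M borel)"
    proof -
      have "(\<lambda>p. (x + \<mu> *\<^sub>R snd p, fst p)) \<in> measurable (borel \<Otimes>\<^sub>M borel) (borel \<Otimes>\<^sub>M borel)"
        by measurable
      from measurable_compose[OF this H_measurable] show ?thesis
        by (simp add: case_prod_unfold borel_measurable_real_of_ereal)
    qed
    have "h\<^sub>s x \<mu> = expectation (\<lambda>\<omega>. ?k (\<xi> \<omega>, v \<omega>))" by (simp add: h\<^sub>s_def)
    also have "\<dots> = (LINT u|distr M borel v. expectation (\<lambda>\<omega>. ?k (\<xi> \<omega>, u)))"
      by (rule expectation_indep_iterated[OF \<xi>_measurable v indep k])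
         (use Fv_integrable in \<open>simp add: F_def\<close>)
    also have "\<dots> = gaussian_smoothing G x \<mu>"
      by (simp add: v_law gaussian_smoothing_def G_def F_def[abs_def])
    finally show "h\<^sub>s x \<mu> = gaussian_smoothing G x \<mu>" .
  qed
  have GD: "GDERIV (\<lambda>y. h\<^sub>s y \<mu>) x :> gaussian_smoothing_gradient G x \<mu>" if "0 < \<mu>" for x \<mu>
    unfolding h\<^sub>s_eq by (rule GDERIV_gaussian_smoothing[OF G_lip that])
  have D_eq: "Dh\<^sub>s x \<mu> = gaussian_smoothing_gradient G x \<mu>" if "0 < \<mu>" for x \<mu>
    unfolding Dh\<^sub>s_def by (rule grad_eq[OF GD[OF that]])
  have smoothing: "smoothing_function X \<mu>b h h\<^sub>s Dh\<^sub>s (L0 * sqrt (real DIM('a))) 0 L0"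
    unfolding h\<^sub>s_eq
    by (rule smoothing_function_gaussian_smoothing[OF G_lip G_convex \<open>0 < L0\<close> \<open>convex X\<close>])
       (simp_all add: D_eq h_def G_def F_def[abs_def])
  have gradient: "has_gradient_on (\<lambda>x. f x + h\<^sub>s x \<mu>) (\<lambda>x. Df x + Dh\<^sub>s x \<mu>) X"
    if "\<mu> \<in> {0<..\<mu>b}" for \<mu>
    using f_gradient smoothing that unfolding smoothing_function_def has_gradient_on_def
    by (auto simp: inner_add_right intro: has_derivative_add)

  have unbiased: "unbiased_bounded_variance M (\<lambda>\<omega>. (\<xi> \<omega>, v \<omega>)) X \<mu>b
           (\<lambda>x \<mu>. Df x + Dh\<^sub>s x \<mu>) (\<lambda>x \<mu> \<zeta>. Df x + g x \<mu> \<zeta>) (L0\<^sup>2)"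
    unfolding unbiased_bounded_variance_def
  proof (intro ballI)
    fix x \<mu> assume x: "x \<in> X" and \<mu>: "\<mu> \<in> {0<..\<mu>b}"
    define Z where "Z \<omega> = g x \<mu> (\<xi> \<omega>, v \<omega>)" for \<omega>
    have Z [measurable]: "Z \<in> borel_measurable M"
      unfolding Z_def by (rule measurable_compose[OF _ g_measurable[OF x \<mu>]]) simp
    have Z_bound: "AE \<omega> in M. norm (Z \<omega>) \<le> L0"
      using H_lipschitz g_subgradient[OF x \<mu>]
      unfolding Z_def by eventually_elim (rule subgradient_norm_le)
    have Z_int: "integrable M Z" by (rule integrable_const_bound[OF Z_bound]) simp
    \<comment> \<open>Integrating the subgradient inequalities makes \<open>expectation Z\<close> a subgradient of the
    differentiable function \<open>h\<^sub>s\<close> at \<open>x\<close>, which determines it.\<close>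
    have "expectation Z = gaussian_smoothing_gradient G x \<mu>"
    proof (rule GDERIV_subgradient_unique[OF GD])
      show "0 < \<mu>" using \<mu> by simp
      fix y
      have "h\<^sub>s x \<mu> + expectation Z \<bullet> (y - x)
          = expectation (\<lambda>\<omega>. F (x + \<mu> *\<^sub>R v \<omega>) \<omega> + Z \<omega> \<bullet> (y - x))"
        using Fv_integrable[of x \<mu>] Z_int by (simp add: h\<^sub>s_def F_def)
      also have "\<dots> \<le> expectation (\<lambda>\<omega>. F (y + \<mu> *\<^sub>R v \<omega>) \<omega>)"
      proof (rule integral_mono_AE)
        show "AE \<omega> in M. F (x + \<mu> *\<^sub>R v \<omega>) \<omega> + Z \<omega> \<bullet> (y - x) \<le> F (y + \<mu> *\<^sub>R v \<omega>) \<omega>"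
          using H_lipschitz g_subgradient[OF x \<mu>]
        proof eventually_elim
          case (elim \<omega>)
          have "F (x + \<mu> *\<^sub>R v \<omega>) \<omega> + Z \<omega> \<bullet> ((y + \<mu> *\<^sub>R v \<omega>) - (x + \<mu> *\<^sub>R v \<omega>))
              \<le> F (y + \<mu> *\<^sub>R v \<omega>) \<omega>"
            unfolding F_def Z_def
            by (rule subgradient_real_le) (use elim in \<open>auto simp: ereal_lipschitz_def\<close>)
          then show ?case by simp
        qed
      qed (use Fv_integrable Z_int in auto)
      also have "\<dots> = h\<^sub>s y \<mu>" by (simp add: h\<^sub>s_def F_def)
      finally show "h\<^sub>s x \<mu> + expectation Z \<bullet> (y - x) \<le> h\<^sub>s y \<mu>" .
    qed
    then have EZ: "Dh\<^sub>s x \<mu> = expectation Z" using \<mu> by (simp add: D_eq)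
    show "integrable M (\<lambda>\<omega>. Df x + g x \<mu> (\<xi> \<omega>, v \<omega>)) \<and>
        (LINT \<omega>|M. Df x + g x \<mu> (\<xi> \<omega>, v \<omega>)) = Df x + Dh\<^sub>s x \<mu> \<and>
        integrable M (\<lambda>\<omega>. (norm (Df x + g x \<mu> (\<xi> \<omega>, v \<omega>) - (Df x + Dh\<^sub>s x \<mu>)))\<^sup>2) \<and>
        (LINT \<omega>|M. (norm (Df x + g x \<mu> (\<xi> \<omega>, v \<omega>) - (Df x + Dh\<^sub>s x \<mu>)))\<^sup>2) \<le> L0\<^sup>2"
      unfolding Z_def[symmetric] EZ
      using Z_int variance_vec_le[OF Z Z_bound] prob_space by simp
  qed

  show ?thesis
    using Fv_integrable GD D_eq smoothing gradient unbiased by (simp add: F_def)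
qed

end
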